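(* For $n\ge1$, in $\mathbf{sSym}$, $$\tilde p_n=\tilde h_n-\sum_{k=0}^{n-1}h_{n-k}\tilde p_k\qquad\text{and}\qquad\tilde e_n=\sum_{k=0}^n(-1)^{n-k}\tilde p_{n-k}e_k.$$
   Context: A superpartition is a pair $\Lambda=(\Lambda_1,\ldots,\Lambda_m;\Lambda_{m+1},\ldots,\Lambda_n)$ of integer sequences with $\Lambda_1>\cdots>\Lambda_m\ge0$ and $\Lambda_{m+1}\ge\cdots\ge\Lambda_n\ge1$; $\mathrm{df}(\Lambda)=m$ and $|\Lambda|=\Lambda_1+\cdots+\Lambda_n$. Let $x=(x_1,x_2,\ldots)$ be commuting variables and $\theta=(\theta_1,\theta_2,\ldots)$ anticommuting variables ($\theta_i\theta_j=-\theta_j\theta_i$, $\theta_i^2=0$), the $\theta$'s commuting with the $x$'s. $\mathbf{sSym}$ is the $\mathbb Q$-algebra of bounded-degree formal power series in $x,\theta$ invariant under all simultaneous permutations of the $x_i$ and $\theta_i$. The monomial function $m_\Lambda$ is the sum of all distinct terms $\theta_{i_1}\cdots\theta_{i_m}x_{i_1}^{\Lambda_1}\cdots x_{i_n}^{\Lambda_n}$ with $i_1,\ldots,i_n$ pairwise distinct. Put $h_r=\sum_{|\Lambda|=r,\,\mathrm{df}(\Lambda)=0}m_\Lambda$ and $e_r=m_{(\emptyset;1^r)}$ for $r\ge1$, $e_0=1$; and for $k\ge0$, $\tilde h_k=\sum_{|\Lambda|=k,\,\mathrm{df}(\Lambda)=1}(\Lambda_1+1)m_\Lambda$, $\tilde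 e_k=m_{(0;1^k)}$ and $\tilde p_k=\sum_i\theta_ix_i^k$. *)

theory Defs
  imports Complex_Main "HOL-Library.Multiset"
begin

section \<open>Formal power series in commuting and anticommuting variables\<close>

text \<open>
  Variables are indexed by \<^typ>\<open>nat\<close>, starting at 0. A monomial \<theta>_S x^a is given by the set S
  of its anticommuting variables, whose product is taken in increasing order of the indices, and
  by a multiset a, in which the multiplicity of i is the exponent of x_i. A series is its
  coefficient function. Infinite S do not occur as monomials.
\<close>

typedef superseries = "{f :: nat set \<Rightarrow> nat multiset \<Rightarrow> rat. \<forall>S a. infinite S \<longrightarrow> f S a = 0}"
  morphisms coeff Abs_superseries
  by (rule exI[of _ "\<lambda>S a. 0"]) auto

setup_lifting type_definition_superseries

text \<open>For disjoint A and B, \<theta>_A \<theta>_B = \<open>shuffle_sign\<close> A B \<theta>_{A \<union> B}.\<close>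

definition shuffle_sign :: "nat set \<Rightarrow> nat set \<Rightarrow> rat" where
  "shuffle_sign A B = (\<Prod>i\<in>A. \<Prod>j\<in>B. if j < i then -1 else 1)"

lemma coeff_infinite [simp]: "infinite S \<Longrightarrow> coeff f S a = 0"
  using coeff[of f] by auto

lemma superseries_eqI: "(\<And>S a. finite S \<Longrightarrow> coeff f S a = coeff g S a) \<Longrightarrow> f = g"
  by (metis coeff_inject coeff_infinite ext)

lemma finite_submsets [simp]: "finite {b. b \<subseteq># (a :: 'a multiset)}"
proof (induction a)
  case (add x a)
  have "{b. b \<subseteq># add_mset x a} \<subseteq> {b. b \<subseteq># a} \<union> add_mset x ` {b. b \<subseteq># a}"
  proof
    fix b assume "b \<in> {b. b \<subseteq># add_mset x a}"
    then have b: "b \<subseteq># add_mset x a" by simp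
    show "b \<in> {b. b \<subseteq># a} \<union> add_mset x ` {b. b \<subseteq># a}"
    proof (cases "x \<in># b")
      case True
      then obtain c where c: "b = add_mset x c" by (meson multi_member_split)
      with b show ?thesis by auto
    next
      case False
      then have "b \<subseteq># a"
        using b by (metis diff_single_trivial subset_eq_diff_conv add_mset_add_single)
      then show ?thesis by auto
    qed
  qed
  then show ?case using add.IH by (meson finite_UnI finite_imageI finite_subset)
qed simp

instantiation superseries :: ring_1
begin

lift_definition zero_superseries :: superseries is "\<lambda>S a. 0" by simp

lift_definition one_superseries :: superseries
  is "\<lambda>S a. if S = {} \<and> a = {#} then 1 else 0" by auto

lift_definition plus_superseries :: "superseries \<Rightarrow> superseries \<Rightarrow> superseries"
  is "\<lambda>f g S a. f S a + g S a" by simp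

lift_definition uminus_superseries :: "superseries \<Rightarrow> superseries"
  is "\<lambda>f S a. - f S a" by simp

lift_definition minus_superseries :: "superseries \<Rightarrow> superseries \<Rightarrow> superseries"
  is "\<lambda>f g S a. f S a - g S a" by simp

lift_definition times_superseries :: "superseries \<Rightarrow> superseries \<Rightarrow> superseries"
  is "\<lambda>f g S a. \<Sum>A\<in>Pow S. \<Sum>b | b \<subseteq># a.
        shuffle_sign A (S - A) * f A b * g (S - A) (a - b)"
  by simp

lemma coeff_times:
  "coeff (f * g) S a = (\<Sum>(A, b)\<in>Pow S \<times> {b. b \<subseteq># a}.
     shuffle_sign A (S - A) * coeff f A b * coeff g (S - A) (a - b))"
  by (simp add: times_superseries.rep_eq sum.cartesian_product)

lemma shuffle_sign_Un1:
  "\<lbrakk>finite A; finite B; A \<inter> B = {}\<rbrakk> \<Longrightarrow>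
    shuffle_sign (A \<union> B) C = shuffle_sign A C * shuffle_sign B C"
  by (simp add: shuffle_sign_def prod.union_disjoint)

lemma shuffle_sign_Un2:
  "\<lbrakk>finite B; finite C; B \<inter> C = {}\<rbrakk> \<Longrightarrow>
    shuffle_sign A (B \<union> C) = shuffle_sign A B * shuffle_sign A C"
  by (simp add: shuffle_sign_def prod.union_disjoint prod.distrib)

lemma shuffle_sign_empty [simp]: "shuffle_sign {} B = 1" "shuffle_sign A {} = 1"
  by (simp_all add: shuffle_sign_def)

lemma times_superseries_assoc: "(f * g) * h = f * (g * h)" for f g h :: superseries
proof (rule superseries_eqI)
  fix S :: "nat set" and a :: "nat multiset"
  assume S: "finite S"
  let ?M = "\<lambda>(S :: nat set) (a :: nat multiset). Pow S \<times> {b. b \<subseteq># a}"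
  let ?L = "Sigma (?M S a) (\<lambda>(D, d). ?M D d)"
  let ?R = "Sigma (?M S a) (\<lambda>(A, b). ?M (S - A) (a - b))"
  let ?l = "\<lambda>((D, d), (A, b)). shuffle_sign D (S - D) *
    (shuffle_sign A (D - A) * coeff f A b * coeff g (D - A) (d - b)) * coeff h (S - D) (a - d)"
  let ?r = "\<lambda>((A, b), (B, c)). shuffle_sign A (S - A) * coeff f A b *
    (shuffle_sign B (S - A - B) * coeff g B c * coeff h (S - A - B) (a - b - c))"
  have fin: "finite (?M S' a')" if "S' \<subseteq> S" for S' a'
    using finite_subset[OF that S] by simp
  have "coeff ((f * g) * h) S a = sum ?l ?L"
    by (subst sum.Sigma[symmetric])
       (auto simp: coeff_times sum_distrib_left sum_distrib_right case_prod_beta S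
          intro!: fin intro: finite_subset[OF _ S] sum.cong)
  also have "\<dots> = sum ?r ?R"
  proof (rule sum.reindex_bij_witness[where
        i = "\<lambda>((A, b), (B, c)). ((A \<union> B, b + c), (A, b))" and
        j = "\<lambda>((D, d), (A, b)). ((A, b), (D - A, d - b))"], goal_cases)
    case (1 x)
    then show ?case by auto
  next
    case (2 x)
    then show ?case by (auto simp: subseteq_mset_def diff_le_mono intro: le_trans)
  next
    case (3 x)
    then show ?case by auto
  next
    case (4 x)
    then show ?case by (auto simp: subset_eq_diff_conv subset_mset.le_diff_conv2 add.commute intro: subset_mset.order_trans)
  next
    case (5 x)
    then obtain D d A b where x: "x = ((D, d), (A, b))"
      and sub: "D \<subseteq> S" "d \<subseteq># a" "A \<subseteq> D" "b \<subseteq># d" by auto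
    have fin': "finite A" "finite (D - A)" "finite (S - D)"
      using S sub by (meson finite_Diff finite_subset)+
    have D: "D = A \<union> (D - A)" and SA: "S - A = (D - A) \<union> (S - D)" using sub by auto
    have e1: "shuffle_sign D (S - D) = shuffle_sign A (S - D) * shuffle_sign (D - A) (S - D)"
      by (subst D, rule shuffle_sign_Un1) (use fin' in auto)
    have e2: "shuffle_sign A (S - A) = shuffle_sign A (D - A) * shuffle_sign A (S - D)"
      by (subst SA, rule shuffle_sign_Un2) (use fin' in auto)
    have e3: "S - A - (D - A) = S - D" using sub by auto
    have e4: "a - b - (d - b) = a - d" using sub(4) by (simp add: multiset_eq_iff subseteq_mset_def)
    show ?case using sub(4) by (simp add: x e1 e2 e3 e4 mult_ac)
  qed
  also have "\<dots> = coeff (f * (g * h)) S a"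
    by (subst sum.Sigma[symmetric])
       (auto simp: coeff_times sum_distrib_left sum_distrib_right case_prod_beta S
          intro!: fin intro: finite_subset[OF _ S] sum.cong)
  finally show "coeff ((f * g) * h) S a = coeff (f * (g * h)) S a" .
qed

lemma times_superseries_one: "1 * f = f" "f * 1 = f" for f :: superseries
proof -
  show "1 * f = f"
  proof (rule superseries_eqI)
    fix S :: "nat set" and a :: "nat multiset"
    assume S: "finite S"
    have "coeff (1 * f) S a = (\<Sum>(A, b)\<in>{({}, {#})}.
        shuffle_sign A (S - A) * coeff 1 A b * coeff f (S - A) (a - b))"
      unfolding coeff_times
      by (rule sum.mono_neutral_right) (auto simp: S one_superseries.rep_eq split: if_splits)
    then show "coeff (1 * f) S a = coeff f S a" by (simp add: one_superseries.rep_eq)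
  qed
  show "f * 1 = f"
  proof (rule superseries_eqI)
    fix S :: "nat set" and a :: "nat multiset"
    assume S: "finite S"
    have "coeff (f * 1) S a = (\<Sum>(A, b)\<in>{(S, a)}.
        shuffle_sign A (S - A) * coeff f A b * coeff 1 (S - A) (a - b))"
      unfolding coeff_times
      by (rule sum.mono_neutral_right)
         (auto simp: S one_superseries.rep_eq Diff_eq_empty_iff_mset
            split: if_splits dest: subset_mset.antisym)
    then show "coeff (f * 1) S a = coeff f S a" by (simp add: one_superseries.rep_eq)
  qed
qed

instance
proof
  fix f g h :: superseries
  show "f + g + h = f + (g + h)" "f + g = g + f" "0 + f = f" "- f + f = 0" "f - g = f + - g"
    by (transfer; simp add: fun_eq_iff)+
  show "(f * g) * h = f * (g * h)" by (rule times_superseries_assoc)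
  show "1 * f = f" "f * 1 = f" by (rule times_superseries_one)+
  show "(f + g) * h = f * h + g * h" "f * (g + h) = f * g + f * h"
    by (transfer; simp add: fun_eq_iff algebra_simps sum.distrib)+
  show "(0 :: superseries) \<noteq> 1"
    by transfer (auto simp: fun_eq_iff)
qed

end

lift_definition var_x :: "nat \<Rightarrow> superseries"
  is "\<lambda>i S a. if S = {} \<and> a = {#i#} then 1 else 0" by auto

lift_definition var_theta :: "nat \<Rightarrow> superseries"
  is "\<lambda>i S a. if S = {i} \<and> a = {#} then 1 else 0" by auto

lemma var_theta_anticommute: "var_theta i * var_theta j = - (var_theta j * var_theta i)"
proof (rule superseries_eqI)
  fix S :: "nat set" and a :: "nat multiset"
  assume S: "finite S"
  have *: "coeff (var_theta k * var_theta l) S a =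
      (if k \<noteq> l \<and> S = {k, l} \<and> a = {#} then if l < k then -1 else 1 else 0)" for k l
  proof (cases "k \<in> S")
    case True
    have "coeff (var_theta k * var_theta l) S a = (\<Sum>(A, b)\<in>{({k}, {#})}.
        shuffle_sign A (S - A) * coeff (var_theta k) A b * coeff (var_theta l) (S - A) (a - b))"
      unfolding coeff_times using True
      by (intro sum.mono_neutral_right) (auto simp: S var_theta.rep_eq split: if_splits)
    with True show ?thesis
      by (auto simp: var_theta.rep_eq shuffle_sign_def)
  next
    case False
    have "coeff (var_theta k * var_theta l) S a = 0"
      unfolding coeff_times using False
      by (intro sum.neutral) (auto simp: var_theta.rep_eq)
    with False show ?thesis by auto
  qed
  show "coeff (var_theta i * var_theta j) S a = coeff (- (var_theta j * var_theta i)) S a"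
    unfolding uminus_superseries.rep_eq * by auto
qed

lemma var_theta_square: "var_theta i * var_theta i = 0"
proof (rule superseries_eqI)
  fix S :: "nat set" and a :: "nat multiset"
  have "coeff (var_theta i * var_theta i) S a = - coeff (var_theta i * var_theta i) S a"
    using arg_cong[OF var_theta_anticommute, of "\<lambda>f. coeff f S a" i i]
    by (simp only: uminus_superseries.rep_eq)
  then show "coeff (var_theta i * var_theta i) S a = coeff 0 S a"
    by (simp add: zero_superseries.rep_eq)
qed

lemma var_x_central: "var_x i * f = f * var_x i"
proof (rule superseries_eqI)
  fix S :: "nat set" and a :: "nat multiset"
  assume S: "finite S"
  have "coeff (var_x i * f) S a = (if i \<in># a then coeff f S (a - {#i#}) else 0)"
  proof (cases "i \<in># a")
    case True
    have "coeff (var_x i * f) S a = (\<Sum>(A, b)\<in>{({}, {#i#})}.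
        shuffle_sign A (S - A) * coeff (var_x i) A b * coeff f (S - A) (a - b))"
      unfolding coeff_times using True
      by (intro sum.mono_neutral_right) (auto simp: S var_x.rep_eq split: if_splits)
    with True show ?thesis by (simp add: var_x.rep_eq)
  next
    case False
    then show ?thesis
      unfolding coeff_times by (auto simp: var_x.rep_eq intro!: sum.neutral)
  qed
  moreover have "coeff (f * var_x i) S a = (if i \<in># a then coeff f S (a - {#i#}) else 0)"
  proof (cases "i \<in># a")
    case True
    have "b = a - {#i#}" if "b \<subseteq># a" "a - b = {#i#}" for b
      using that by (metis add_diff_cancel_right' subset_mset.diff_add add.commute)
    moreover have "a - (a - {#i#}) = {#i#}" using True by (auto dest!: multi_member_split)
    ultimately have "coeff (f * var_x i) S a = (\<Sum>(A, b)\<in>{(S, a - {#i#})}.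
        shuffle_sign A (S - A) * coeff f A b * coeff (var_x i) (S - A) (a - b))"
      unfolding coeff_times
      by (intro sum.mono_neutral_right) (auto simp: S var_x.rep_eq split: if_splits)
    with True \<open>a - (a - {#i#}) = {#i#}\<close> show ?thesis by (simp add: var_x.rep_eq)
  next
    case False
    then have "a - b \<noteq> {#i#}" for b by (metis in_diffD union_single_eq_member add_mset_eq_singleton_iff)
    then show ?thesis
      unfolding coeff_times using False by (auto simp: var_x.rep_eq intro!: sum.neutral)
  qed
  ultimately show "coeff (var_x i * f) S a = coeff (f * var_x i) S a" by simp
qed

text \<open>
  The sum of a possibly infinite family of series, meaningful if every monomial has a nonzero
  coefficient in only finitely many members of the family.
\<close>

lift_definition formal_sum :: "('b \<Rightarrow> superseries) \<Rightarrow> 'b set \<Rightarrow> superseries"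
  is "\<lambda>F I S a. \<Sum>i | i \<in> I \<and> coeff (F i) S a \<noteq> 0. coeff (F i) S a"
  by auto


section \<open>The algebra of symmetric functions in superspace\<close>

text \<open>
  Under the substitution sending each x_i to x_\<open>\<sigma> i\<close> and each \<theta>_i to \<theta>_\<open>\<sigma> i\<close>, the monomial
  \<theta>_S x^a becomes \<open>perm_sign\<close> \<sigma> S times the monomial with set \<open>\<sigma> ` S\<close> and exponents
  \<open>image_mset \<sigma> a\<close>.
\<close>

definition perm_sign :: "(nat \<Rightarrow> nat) \<Rightarrow> nat set \<Rightarrow> rat" where
  "perm_sign \<sigma> S = (\<Prod>i\<in>S. \<Prod>j\<in>S. if i < j \<and> \<sigma> j < \<sigma> i then -1 else 1)"

lift_definition permute_vars :: "(nat \<Rightarrow> nat) \<Rightarrow> superseries \<Rightarrow> superseries"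
  is "\<lambda>\<sigma> f S a. if finite S
       then perm_sign \<sigma> (inv \<sigma> ` S) * f (inv \<sigma> ` S) (image_mset (inv \<sigma>) a) else 0"
  by simp

definition degree_le :: "nat \<Rightarrow> superseries \<Rightarrow> bool" where
  "degree_le d f \<longleftrightarrow> (\<forall>S a. coeff f S a \<noteq> 0 \<longrightarrow> card S + size a \<le> d)"

definition sSym_set :: "superseries set" where
  "sSym_set = {f. (\<exists>d. degree_le d f) \<and> (\<forall>\<sigma>. bij \<sigma> \<longrightarrow> permute_vars \<sigma> f = f)}"

lemma degree_le_times:
  assumes "degree_le d f" "degree_le e g" shows "degree_le (d + e) (f * g)"
  unfolding degree_le_def
proof (intro allI impI)
  fix S a assume *: "coeff (f * g) S a \<noteq> 0"
  then have S: "finite S" using coeff_infinite by blast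
  from * obtain A b where A: "A \<subseteq> S" "b \<subseteq># a" "coeff f A b \<noteq> 0" "coeff g (S - A) (a - b) \<noteq> 0"
    unfolding coeff_times by (elim sum.not_neutral_contains_not_neutral) auto
  have "card A + size b \<le> d" "card (S - A) + size (a - b) \<le> e"
    using A assms by (auto simp: degree_le_def)
  moreover have "card S = card A + card (S - A)"
    using A(1) S by (metis card_Diff_subset card_mono finite_subset le_add_diff_inverse)
  moreover have "size a = size b + size (a - b)"
    using A(2) by (metis size_union subset_mset.add_diff_inverse)
  ultimately show "card S + size a \<le> d + e" by simp
qed

lemma degree_le_0_1: "degree_le d 0" "degree_le d 1"
  by (auto simp: degree_le_def zero_superseries.rep_eq one_superseries.rep_eq split: if_splits)

lemma degree_le_mono: "degree_le d f \<Longrightarrow> d \<le> e \<Longrightarrow> degree_le e f"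
  by (force simp: degree_le_def)

lemma perm_sign_Un:
  assumes \<sigma>: "inj \<sigma>" and fin: "finite A" "finite B" and disj: "A \<inter> B = {}"
  shows "shuffle_sign A B * perm_sign \<sigma> (A \<union> B) =
    perm_sign \<sigma> A * perm_sign \<sigma> B * shuffle_sign (\<sigma> ` A) (\<sigma> ` B)"
proof -
  let ?p = "\<lambda>i j. if i < j \<and> \<sigma> j < \<sigma> i then -1 else 1 :: rat"
  have 1: "perm_sign \<sigma> (A \<union> B) = perm_sign \<sigma> A * perm_sign \<sigma> B *
      (\<Prod>i\<in>A. \<Prod>j\<in>B. ?p i j) * (\<Prod>i\<in>B. \<Prod>j\<in>A. ?p i j)"
    unfolding perm_sign_def
    by (simp add: prod.union_disjoint[OF fin disj] prod.distrib mult_ac)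
  have 2: "(\<Prod>i\<in>B. \<Prod>j\<in>A. ?p i j) = (\<Prod>i\<in>A. \<Prod>j\<in>B. ?p j i)"
    by (rule prod.swap)
  have 3: "shuffle_sign (\<sigma> ` A) (\<sigma> ` B) = (\<Prod>i\<in>A. \<Prod>j\<in>B. if \<sigma> j < \<sigma> i then -1 else 1)"
    unfolding shuffle_sign_def using \<sigma>
    by (subst prod.reindex, force simp: inj_on_def)
       (rule prod.cong[OF refl], simp, subst prod.reindex, auto simp: inj_on_def)
  have 4: "shuffle_sign A B * (\<Prod>i\<in>A. \<Prod>j\<in>B. ?p i j) * (\<Prod>i\<in>A. \<Prod>j\<in>B. ?p j i)
      = (\<Prod>i\<in>A. \<Prod>j\<in>B. if \<sigma> j < \<sigma> i then -1 else 1)"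
    unfolding shuffle_sign_def prod.distrib[symmetric]
  proof (intro prod.cong refl)
    fix i j assume "i \<in> A" "j \<in> B"
    then have "i \<noteq> j" "\<sigma> i \<noteq> \<sigma> j" using disj \<sigma> by (auto dest: injD)
    then show "(if j < i then -1 else 1) * ?p i j * ?p j i = (if \<sigma> j < \<sigma> i then -1 else 1)"
      by auto
  qed
  show ?thesis using 1 2 3 4 by (simp add: mult_ac)
qed

lemma permute_vars_times:
  assumes \<sigma>: "bij \<sigma>"
  shows "permute_vars \<sigma> (f * g) = permute_vars \<sigma> f * permute_vars \<sigma> g"
proof (rule superseries_eqI)
  fix S :: "nat set" and a :: "nat multiset"
  assume S: "finite S"
  let ?\<tau> = "inv \<sigma>"
  have \<tau>: "bij ?\<tau>" "inj ?\<tau>" "inj \<sigma>" using \<sigma> by (auto simp: bij_imp_bij_inv bij_is_inj)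
  have [simp]: "\<sigma> (?\<tau> i) = i" "?\<tau> (\<sigma> i) = i" for i
    using \<sigma> by (auto simp: bij_is_surj surj_f_inv_f bij_is_inj)
  have img [simp]: "\<sigma> ` ?\<tau> ` A = A" "?\<tau> ` \<sigma> ` A = A" for A by (auto simp: image_image)
  have imgm [simp]: "image_mset \<sigma> (image_mset ?\<tau> m) = m" "image_mset ?\<tau> (image_mset \<sigma> m) = m" for m
    by (simp_all add: multiset.map_comp comp_def)
  have "coeff (permute_vars \<sigma> (f * g)) S a =
    (\<Sum>(A, b)\<in>Pow (?\<tau> ` S) \<times> {b. b \<subseteq># image_mset ?\<tau> a}. perm_sign \<sigma> (?\<tau> ` S) *
      (shuffle_sign A (?\<tau> ` S - A) * coeff f A b * coeff g (?\<tau> ` S - A) (image_mset ?\<tau> a - b)))"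
    by (simp add: permute_vars.rep_eq S coeff_times sum_distrib_left case_prod_beta)
  also have "\<dots> = (\<Sum>(A, b)\<in>Pow S \<times> {b. b \<subseteq># a}. shuffle_sign A (S - A) *
      coeff (permute_vars \<sigma> f) A b * coeff (permute_vars \<sigma> g) (S - A) (a - b))"
  proof (rule sum.reindex_bij_witness[where
        i = "\<lambda>(A, b). (?\<tau> ` A, image_mset ?\<tau> b)" and
        j = "\<lambda>(A, b). (\<sigma> ` A, image_mset \<sigma> b)"], goal_cases)
    case (1 x)
    then show ?case by auto
  next
    case (2 x)
    then show ?case by (auto dest: image_mset_subseteq_mono[of _ _ \<sigma>])
  next
    case (3 x)
    then show ?case by auto
  next
    case (4 x)
    then show ?case by (auto intro: image_mset_subseteq_mono)
  next
    case (5 x)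
    then obtain A b where x: "x = (A, b)" and A: "A \<subseteq> ?\<tau> ` S" and b: "b \<subseteq># image_mset ?\<tau> a"
      by auto
    have \<sigma>A: "\<sigma> ` A \<subseteq> S" using A by auto
    have \<sigma>b: "image_mset \<sigma> b \<subseteq># a" using image_mset_subseteq_mono[OF b, of \<sigma>] by simp
    have finA: "finite A" using A S finite_surj by blast
    have e1: "?\<tau> ` (S - \<sigma> ` A) = ?\<tau> ` S - A"
      by (simp add: image_set_diff[OF \<tau>(2)])
    have e2: "image_mset ?\<tau> (a - image_mset \<sigma> b) = image_mset ?\<tau> a - b"
      by (simp add: image_mset_Diff[OF \<sigma>b])
    have e3: "A \<union> (?\<tau> ` S - A) = ?\<tau> ` S" using A by auto
    have e4: "\<sigma> ` (?\<tau> ` S - A) = S - \<sigma> ` A" by (simp add: image_set_diff[OF \<tau>(3)])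
    have "shuffle_sign A (?\<tau> ` S - A) * perm_sign \<sigma> (?\<tau> ` S) =
      perm_sign \<sigma> A * perm_sign \<sigma> (?\<tau> ` S - A) * shuffle_sign (\<sigma> ` A) (S - \<sigma> ` A)"
      using perm_sign_Un[OF \<tau>(3) finA, of "?\<tau> ` S - A"] S unfolding e3 e4 by auto
    then show ?case
      by (simp add: x permute_vars.rep_eq S finA e1 e2 mult_ac)
  qed
  finally show "coeff (permute_vars \<sigma> (f * g)) S a =
      coeff (permute_vars \<sigma> f * permute_vars \<sigma> g) S a"
    by (simp add: coeff_times)
qed

lemma permute_vars_0_1: "permute_vars \<sigma> 0 = 0" "permute_vars \<sigma> 1 = 1"
  by (rule superseries_eqI, force simp: permute_vars.rep_eq zero_superseries.rep_eq
      one_superseries.rep_eq perm_sign_def)+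

lemma sSym_set_ring:
  "0 \<in> sSym_set" "1 \<in> sSym_set"
  "f \<in> sSym_set \<Longrightarrow> g \<in> sSym_set \<Longrightarrow> f + g \<in> sSym_set"
  "f \<in> sSym_set \<Longrightarrow> g \<in> sSym_set \<Longrightarrow> f - g \<in> sSym_set"
  "f \<in> sSym_set \<Longrightarrow> - f \<in> sSym_set"
  "f \<in> sSym_set \<Longrightarrow> g \<in> sSym_set \<Longrightarrow> f * g \<in> sSym_set"
proof -
  show "0 \<in> sSym_set" "1 \<in> sSym_set"
    using degree_le_0_1 permute_vars_0_1 by (auto simp: sSym_set_def)
  have um: "- f \<in> sSym_set" if "f \<in> sSym_set" for f
  proof -
    have "permute_vars \<sigma> (- f) = - permute_vars \<sigma> f" for \<sigma>
      by (rule superseries_eqI) (simp add: permute_vars.rep_eq uminus_superseries.rep_eq)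
    with that show ?thesis by (auto simp: sSym_set_def degree_le_def uminus_superseries.rep_eq)
  qed
  then show "f \<in> sSym_set \<Longrightarrow> - f \<in> sSym_set" .
  have pl: "f + g \<in> sSym_set" if fg: "f \<in> sSym_set" "g \<in> sSym_set" for f g
  proof -
    have "permute_vars \<sigma> (f + g) = permute_vars \<sigma> f + permute_vars \<sigma> g" for \<sigma>
      by (rule superseries_eqI) (simp add: permute_vars.rep_eq plus_superseries.rep_eq algebra_simps)
    moreover obtain d e where "degree_le d f" "degree_le e g"
      using fg by (auto simp: sSym_set_def)
    then have "degree_le (max d e) f" "degree_le (max d e) g" by (auto intro: degree_le_mono)
    then have "degree_le (max d e) (f + g)"
      unfolding degree_le_def plus_superseries.rep_eq by (metis add.right_neutral)
    ultimately show ?thesis using fg by (auto simp: sSym_set_def)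
  qed
  then show "f \<in> sSym_set \<Longrightarrow> g \<in> sSym_set \<Longrightarrow> f + g \<in> sSym_set" .
  show "f \<in> sSym_set \<Longrightarrow> g \<in> sSym_set \<Longrightarrow> f - g \<in> sSym_set"
    using pl[of f "- g"] um[of g] by simp
  show "f \<in> sSym_set \<Longrightarrow> g \<in> sSym_set \<Longrightarrow> f * g \<in> sSym_set"
    by (auto simp: sSym_set_def permute_vars_times intro: degree_le_times)
qed

typedef sSym = sSym_set
  using sSym_set_ring(1) by blast

setup_lifting type_definition_sSym

instantiation sSym :: ring_1
begin

lift_definition zero_sSym :: sSym is 0 by (rule sSym_set_ring)
lift_definition one_sSym :: sSym is 1 by (rule sSym_set_ring)
lift_definition plus_sSym :: "sSym \<Rightarrow> sSym \<Rightarrow> sSym" is "(+)" by (rule sSym_set_ring)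
lift_definition minus_sSym :: "sSym \<Rightarrow> sSym \<Rightarrow> sSym" is "(-)" by (rule sSym_set_ring)
lift_definition uminus_sSym :: "sSym \<Rightarrow> sSym" is uminus by (rule sSym_set_ring)
lift_definition times_sSym :: "sSym \<Rightarrow> sSym \<Rightarrow> sSym" is "(*)" by (rule sSym_set_ring)

instance
  by standard (transfer; simp add: algebra_simps)+

end


section \<open>Superpartitions, monomial functions and generators\<close>

text \<open>
  A pair (L, M) stands for (\<Lambda>_1, ..., \<Lambda>_m; \<Lambda>_{m+1}, ..., \<Lambda>_n) with L = [\<Lambda>_1, ..., \<Lambda>_m] and
  M = [\<Lambda>_{m+1}, ..., \<Lambda>_n].
\<close>

type_synonym superpart = "nat list \<times> nat list"

definition superpartitions :: "superpart set" where
  "superpartitions = {(L, M). sorted_wrt (>) L \<and> sorted_wrt (\<ge>) M \<and> (\<forall>k\<in>set M. 1 \<le> k)}"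

definition df :: "superpart \<Rightarrow> nat" where
  "df \<Lambda> = length (fst \<Lambda>)"

definition weight :: "superpart \<Rightarrow> nat" where
  "weight \<Lambda> = sum_list (fst \<Lambda>) + sum_list (snd \<Lambda>)"

text \<open>The product \<theta>_{i_1} ... \<theta>_{i_m} x_{i_1}^{\<Lambda>_1} ... x_{i_n}^{\<Lambda>_n} for is = [i_1, ..., i_n].\<close>

definition super_term :: "superpart \<Rightarrow> nat list \<Rightarrow> superseries" where
  "super_term \<Lambda> is =
     prod_list (map var_theta (take (df \<Lambda>) is)) *
     prod_list (map2 (\<lambda>i k. var_x i ^ k) is (fst \<Lambda> @ snd \<Lambda>))"

definition super_terms :: "superpart \<Rightarrow> superseries set" where
  "super_terms \<Lambda> = {super_term \<Lambda> is | is.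
     distinct is \<and> length is = length (fst \<Lambda>) + length (snd \<Lambda>)}"

lemma permute_vars_var:
  assumes "bij \<sigma>"
  shows "permute_vars \<sigma> (var_x i) = var_x (\<sigma> i)" "permute_vars \<sigma> (var_theta i) = var_theta (\<sigma> i)"
proof -
  have [simp]: "\<sigma> (inv \<sigma> i) = i" "inv \<sigma> (\<sigma> i) = i" for i
    using assms by (auto simp: bij_is_surj surj_f_inv_f bij_is_inj)
  have a: "image_mset (inv \<sigma>) a = {#i#} \<longleftrightarrow> a = {#\<sigma> i#}" for a
  proof
    assume "image_mset (inv \<sigma>) a = {#i#}"
    then have "image_mset \<sigma> (image_mset (inv \<sigma>) a) = {#\<sigma> i#}" by simp
    then show "a = {#\<sigma> i#}" by (simp add: multiset.map_comp comp_def)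
  qed simp
  have S: "inv \<sigma> ` S = {i} \<longleftrightarrow> S = {\<sigma> i}" for S
  proof
    assume "inv \<sigma> ` S = {i}"
    then have "\<sigma> ` inv \<sigma> ` S = {\<sigma> i}" by simp
    then show "S = {\<sigma> i}" by (simp add: image_image)
  qed simp
  show "permute_vars \<sigma> (var_x i) = var_x (\<sigma> i)"
    by (rule superseries_eqI) (auto simp: permute_vars.rep_eq var_x.rep_eq perm_sign_def a)
  show "permute_vars \<sigma> (var_theta i) = var_theta (\<sigma> i)"
    by (rule superseries_eqI) (auto simp: permute_vars.rep_eq var_theta.rep_eq perm_sign_def S)
qed

lemma permute_vars_power: "bij \<sigma> \<Longrightarrow> permute_vars \<sigma> (f ^ k) = permute_vars \<sigma> f ^ k"
  by (induction k) (simp_all add: permute_vars_0_1 permute_vars_times)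

lemma permute_vars_prod_list:
  "bij \<sigma> \<Longrightarrow> permute_vars \<sigma> (prod_list fs) = prod_list (map (permute_vars \<sigma>) fs)"
  by (induction fs) (simp_all add: permute_vars_0_1 permute_vars_times)

lemma permute_super_term:
  assumes "bij \<sigma>"
  shows "permute_vars \<sigma> (super_term \<Lambda> is) = super_term \<Lambda> (map \<sigma> is)"
proof -
  have "map (permute_vars \<sigma> \<circ> (\<lambda>(i, k). var_x i ^ k)) (zip is ks) =
      map2 (\<lambda>i k. var_x i ^ k) (map \<sigma> is) ks" for ks
    using assms by (simp add: zip_map1 permute_vars_power permute_vars_var case_prod_beta)
  moreover have "permute_vars \<sigma> \<circ> var_theta = var_theta \<circ> \<sigma>"
    using assms by (simp add: fun_eq_iff permute_vars_var)
  ultimately show ?thesis using assms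
    by (simp add: super_term_def permute_vars_times permute_vars_prod_list take_map)
qed

lemma perm_sign_nonzero: "finite S \<Longrightarrow> perm_sign \<sigma> S \<noteq> 0"
  by (simp add: perm_sign_def)

lemma inj_permute_vars:
  assumes "bij \<sigma>" shows "inj (permute_vars \<sigma>)"
proof (rule injI)
  fix f g assume eq: "permute_vars \<sigma> f = permute_vars \<sigma> g"
  have [simp]: "inv \<sigma> (\<sigma> i) = i" for i using assms by (simp add: bij_is_inj)
  show "f = g"
  proof (rule superseries_eqI)
    fix S :: "nat set" and a :: "nat multiset"
    assume "finite S"
    moreover have "coeff (permute_vars \<sigma> f) (\<sigma> ` S) (image_mset \<sigma> a) =
        coeff (permute_vars \<sigma> g) (\<sigma> ` S) (image_mset \<sigma> a)"
      by (simp add: eq)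
    ultimately show "coeff f S a = coeff g S a"
      by (simp add: permute_vars.rep_eq perm_sign_nonzero image_image multiset.map_comp comp_def)
  qed
qed

lemma permute_formal_sum: "permute_vars \<sigma> (formal_sum F I) = formal_sum (\<lambda>i. permute_vars \<sigma> (F i)) I"
  by (rule superseries_eqI)
     (simp add: permute_vars.rep_eq formal_sum.rep_eq perm_sign_nonzero sum_distrib_left)

lemma formal_sum_reindex:
  assumes "bij_betw h I J" shows "formal_sum (\<lambda>i. F (h i)) I = formal_sum F J"
proof (rule superseries_eqI)
  fix S :: "nat set" and a :: "nat multiset"
  have "bij_betw h {i \<in> I. coeff (F (h i)) S a \<noteq> 0} {j \<in> J. coeff (F j) S a \<noteq> 0}"
    using assms by (auto simp: bij_betw_def inj_on_def)
  from sum.reindex_bij_betw[OF this, of "\<lambda>j. coeff (F j) S a"]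
  show "coeff (formal_sum (\<lambda>i. F (h i)) I) S a = coeff (formal_sum F J) S a"
    by (simp add: formal_sum.rep_eq)
qed

lemma degree_le_formal_sum:
  assumes "\<And>i. i \<in> I \<Longrightarrow> degree_le d (F i)" shows "degree_le d (formal_sum F I)"
  unfolding degree_le_def
proof (intro allI impI)
  fix S a assume "coeff (formal_sum F I) S a \<noteq> 0"
  then obtain i where "i \<in> I" "coeff (F i) S a \<noteq> 0"
    unfolding formal_sum.rep_eq by (elim sum.not_neutral_contains_not_neutral) auto
  then show "card S + size a \<le> d" using assms by (auto simp: degree_le_def)
qed

lemma degree_le_var: "degree_le 1 (var_x i)" "degree_le 1 (var_theta i)"
  by (auto simp: degree_le_def var_x.rep_eq var_theta.rep_eq split: if_splits)

lemma degree_le_power: "degree_le d f \<Longrightarrow> degree_le (k * d) (f ^ k)"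
  by (induction k) (auto simp: degree_le_0_1 intro: degree_le_times)

lemma degree_le_thetas: "degree_le (length is) (prod_list (map var_theta is))"
  using degree_le_times[OF degree_le_var(2)] by (induction "is") (auto simp: degree_le_0_1)

lemma degree_le_xs: "degree_le (sum_list ks) (prod_list (map2 (\<lambda>i k. var_x i ^ k) is ks))"
proof (induction ks arbitrary: "is")
  case (Cons k ks)
  show ?case
  proof (cases "is")
    case (Cons i js)
    then show ?thesis
      using degree_le_times[OF degree_le_power[OF degree_le_var(1), of k i] Cons.IH[of js]] by simp
  qed (simp add: degree_le_0_1)
qed (simp add: degree_le_0_1)

lemma degree_le_super_term: "degree_le (df \<Lambda> + weight \<Lambda>) (super_term \<Lambda> is)"
  unfolding super_term_def
  by (rule degree_le_times)
     (use degree_le_thetas[of "take (df \<Lambda>) is"] degree_le_xs[of "fst \<Lambda> @ snd \<Lambda>" "is"] in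
       \<open>auto simp: weight_def intro: degree_le_mono\<close>)

lemma bij_betw_super_terms:
  assumes "bij \<sigma>" shows "bij_betw (permute_vars \<sigma>) (super_terms \<Lambda>) (super_terms \<Lambda>)"
  unfolding bij_betw_def
proof
  show "inj_on (permute_vars \<sigma>) (super_terms \<Lambda>)"
    using inj_permute_vars[OF assms] by (rule inj_on_subset) simp
  have sub: "permute_vars \<rho> t \<in> super_terms \<Lambda>" if \<rho>: "bij \<rho>" and t: "t \<in> super_terms \<Lambda>" for \<rho> t
  proof -
    obtain "is" where "is": "t = super_term \<Lambda> is" "distinct is"
      "length is = length (fst \<Lambda>) + length (snd \<Lambda>)"
      using t unfolding super_terms_def by blast
    have "distinct (map \<rho> is)"
      using "is"(2) \<rho> by (auto simp: distinct_map intro: inj_on_subset[OF bij_is_inj])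
    then show ?thesis
      using "is" \<rho> unfolding super_terms_def
      by (intro CollectI exI[of _ "map \<rho> is"]) (simp add: permute_super_term)
  qed
  show "permute_vars \<sigma> ` super_terms \<Lambda> = super_terms \<Lambda>"
  proof (intro equalityI subsetI)
    fix t assume "t \<in> super_terms \<Lambda>"
    then obtain "is" where "is": "t = super_term \<Lambda> is" "distinct is"
      "length is = length (fst \<Lambda>) + length (snd \<Lambda>)"
      by (auto simp: super_terms_def)
    have inv: "bij (inv \<sigma>)" using assms by (rule bij_imp_bij_inv)
    have "map \<sigma> (map (inv \<sigma>) is) = is"
      using assms by (simp add: bij_is_surj surj_f_inv_f map_idI)
    then have "t = permute_vars \<sigma> (permute_vars (inv \<sigma>) t)"
      by (simp only: "is"(1) permute_super_term[OF assms] permute_super_term[OF inv])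
    then show "t \<in> permute_vars \<sigma> ` super_terms \<Lambda>"
      using sub[OF inv \<open>t \<in> super_terms \<Lambda>\<close>] by blast
  qed (use sub assms in auto)
qed

text \<open>
  The formal sums below are well-defined: only finitely many terms contribute to each monomial.
\<close>

definition signed_monomial :: "superseries \<Rightarrow> bool" where
  "signed_monomial f \<longleftrightarrow> (\<exists>S a c. finite S \<and> c \<in> {-1, 0, 1} \<and>
     (\<forall>T b. coeff f T b = (if T = S \<and> b = a then c else 0)))"

lemma signed_monomial_1: "signed_monomial 1"
  unfolding signed_monomial_def
  by (rule exI[of _ "{}"], rule exI[of _ "{#}"], rule exI[of _ 1]) (simp add: one_superseries.rep_eq)

lemma signed_monomial_x: "signed_monomial (var_x i)"
  unfolding signed_monomial_def
  by (rule exI[of _ "{}"], rule exI[of _ "{#i#}"], rule exI[of _ 1]) (simp add: var_x.rep_eq)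

lemma signed_monomial_theta: "signed_monomial (var_theta i)"
  unfolding signed_monomial_def
  by (rule exI[of _ "{i}"], rule exI[of _ "{#}"], rule exI[of _ 1]) (simp add: var_theta.rep_eq)

lemma shuffle_sign_cases: "finite A \<Longrightarrow> finite B \<Longrightarrow> shuffle_sign A B \<in> {-1, 1}"
proof -
  have *: "(\<Prod>i\<in>A. f i) \<in> {-1, 1}" if "\<And>i. f i \<in> {-1, 1}" for f :: "nat \<Rightarrow> rat" and A
  proof (induction A rule: infinite_finite_induct)
    case (insert x F)
    then show ?case using that[of x] by auto
  qed auto
  show ?thesis unfolding shuffle_sign_def by (intro *) auto
qed

lemma signed_monomial_times:
  assumes "signed_monomial f" "signed_monomial g" shows "signed_monomial (f * g)"
proof -
  obtain S a c where f: "finite S" "c \<in> {-1, 0, 1}"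
    "\<And>T b. coeff f T b = (if T = S \<and> b = a then c else 0)"
    using assms(1) unfolding signed_monomial_def by blast
  obtain S' a' c' where g: "finite S'" "c' \<in> {-1, 0, 1}"
    "\<And>T b. coeff g T b = (if T = S' \<and> b = a' then c' else 0)"
    using assms(2) unfolding signed_monomial_def by blast
  define d where "d = (if S \<inter> S' = {} then shuffle_sign S S' * c * c' else 0)"
  have "coeff (f * g) T b = (if T = S \<union> S' \<and> b = a + a' then d else 0)" for T b
  proof (cases "finite T")
    case True
    show ?thesis
    proof (cases "S \<subseteq> T \<and> a \<subseteq># b")
      case sub: True
      have "coeff (f * g) T b = (\<Sum>(A, e)\<in>{(S, a)}.
          shuffle_sign A (T - A) * coeff f A e * coeff g (T - A) (b - e))"
        unfolding coeff_times using sub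
        by (intro sum.mono_neutral_right) (auto simp: True f(3) split: if_splits)
      also have "\<dots> = shuffle_sign S (T - S) * c * (if T - S = S' \<and> b - a = a' then c' else 0)"
        by (simp add: f(3) g(3))
      also have "\<dots> = (if T = S \<union> S' \<and> b = a + a' then d else 0)"
      proof -
        have 1: "b - a = a' \<longleftrightarrow> b = a + a'" using sub by auto
        have 2: "T - S = S' \<longleftrightarrow> T = S \<union> S' \<and> S \<inter> S' = {}" using sub by auto
        have 3: "S \<union> S' - S = S'" if "S \<inter> S' = {}" using that by auto
        show ?thesis unfolding 1 2 d_def using 3 by auto
      qed
      finally show ?thesis .
    next
      case False
      have "coeff (f * g) T b = 0"
        unfolding coeff_times using False by (intro sum.neutral) (auto simp: f(3))
      with False show ?thesis by auto
    qed
  next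
    case False
    then show ?thesis using f(1) g(1) by auto
  qed
  moreover have "d \<in> {-1, 0, 1}"
    using shuffle_sign_cases[OF f(1) g(1)] f(2) g(2) by (auto simp: d_def)
  ultimately show ?thesis
    unfolding signed_monomial_def using f(1) g(1) by (intro exI[of _ "S \<union> S'"] exI[of _ "a + a'"] exI[of _ d]) auto
qed

lemma signed_monomial_power: "signed_monomial f \<Longrightarrow> signed_monomial (f ^ k)"
  by (induction k) (auto simp: signed_monomial_1 intro: signed_monomial_times)

lemma signed_monomial_prod_list:
  "(\<And>f. f \<in> set fs \<Longrightarrow> signed_monomial f) \<Longrightarrow> signed_monomial (prod_list fs)"
  by (induction fs) (auto simp: signed_monomial_1 intro: signed_monomial_times)

lemma signed_monomial_super_term: "signed_monomial (super_term \<Lambda> is)"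
  unfolding super_term_def
  by (intro signed_monomial_times signed_monomial_prod_list)
     (auto simp: signed_monomial_theta intro: signed_monomial_power signed_monomial_x)

lemma finite_contributing_terms: "finite {t \<in> super_terms \<Lambda>. coeff t S a \<noteq> 0}"
proof (rule inj_on_finite[where f = "\<lambda>t. coeff t S a"])
  have *: "coeff t S a \<in> {-1, 0, 1} \<and>
      (coeff t S a \<noteq> 0 \<longrightarrow> (\<forall>T b. coeff t T b = (if T = S \<and> b = a then coeff t S a else 0)))"
    if "t \<in> super_terms \<Lambda>" for t
  proof -
    have "signed_monomial t"
      using that signed_monomial_super_term unfolding super_terms_def by blast
    then obtain S' a' c where "c \<in> {-1, 0, 1}"
      "\<And>T b. coeff t T b = (if T = S' \<and> b = a' then c else 0)"
      unfolding signed_monomial_def by blast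
    then show ?thesis by auto
  qed
  show "inj_on (\<lambda>t. coeff t S a) {t \<in> super_terms \<Lambda>. coeff t S a \<noteq> 0}"
  proof (rule inj_onI)
    fix t u assume t: "t \<in> {t \<in> super_terms \<Lambda>. coeff t S a \<noteq> 0}"
      and u: "u \<in> {t \<in> super_terms \<Lambda>. coeff t S a \<noteq> 0}" and eq: "coeff t S a = coeff u S a"
    show "t = u"
    proof (rule superseries_eqI)
      fix T b
      have "coeff t T b = (if T = S \<and> b = a then coeff t S a else 0)"
        "coeff u T b = (if T = S \<and> b = a then coeff u S a else 0)"
        using *[of t] *[of u] t u by blast+
      with eq show "coeff t T b = coeff u T b" by simp
    qed
  qed
  show "(\<lambda>t. coeff t S a) ` {t \<in> super_terms \<Lambda>. coeff t S a \<noteq> 0} \<subseteq> {-1, 0, 1}"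
    using * by blast
qed simp

lemma finite_contributing_p_tilde: "finite {i. coeff (var_theta i * var_x i ^ k) S a \<noteq> 0}"
proof (rule finite_subset)
  have "i \<in> S" if "coeff (var_theta i * f) S a \<noteq> 0" for i f
    using that unfolding coeff_times
    by (elim sum.not_neutral_contains_not_neutral) (auto simp: var_theta.rep_eq split: if_splits)
  then show "{i. coeff (var_theta i * var_x i ^ k) S a \<noteq> 0} \<subseteq> (if finite S then S else {})"
    by auto
qed simp

lift_definition mon :: "superpart \<Rightarrow> sSym"
  is "\<lambda>\<Lambda>. formal_sum (\<lambda>t. t) (super_terms \<Lambda>)"
proof -
  fix \<Lambda> :: superpart
  have "permute_vars \<sigma> (formal_sum (\<lambda>t. t) (super_terms \<Lambda>)) = formal_sum (\<lambda>t. t) (super_terms \<Lambda>)"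
    if "bij \<sigma>" for \<sigma>
    using formal_sum_reindex[OF bij_betw_super_terms[OF that], of "\<lambda>t. t"]
    by (simp add: permute_formal_sum)
  moreover have "degree_le (df \<Lambda> + weight \<Lambda>) (formal_sum (\<lambda>t. t) (super_terms \<Lambda>))"
    by (rule degree_le_formal_sum) (auto simp: super_terms_def degree_le_super_term)
  ultimately show "formal_sum (\<lambda>t. t) (super_terms \<Lambda>) \<in> sSym_set"
    by (auto simp: sSym_set_def)
qed

lift_definition p_tilde :: "nat \<Rightarrow> sSym"
  is "\<lambda>k. formal_sum (\<lambda>i. var_theta i * var_x i ^ k) UNIV"
proof -
  fix k :: nat
  let ?F = "\<lambda>i. var_theta i * var_x i ^ k"
  have "permute_vars \<sigma> (formal_sum ?F UNIV) = formal_sum ?F UNIV" if "bij \<sigma>" for \<sigma>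
    using formal_sum_reindex[of \<sigma> UNIV UNIV ?F] that
    by (simp add: permute_formal_sum permute_vars_times permute_vars_power permute_vars_var)
  moreover have "degree_le (1 + k * 1) (formal_sum ?F UNIV)"
    by (intro degree_le_formal_sum degree_le_times degree_le_power degree_le_var)
  ultimately show "formal_sum ?F UNIV \<in> sSym_set"
    unfolding sSym_set_def by blast
qed

definition h_sum :: "nat \<Rightarrow> sSym" where
  "h_sum r = (\<Sum>\<Lambda> | \<Lambda> \<in> superpartitions \<and> weight \<Lambda> = r \<and> df \<Lambda> = 0. mon \<Lambda>)"

definition e_sum :: "nat \<Rightarrow> sSym" where
  "e_sum r = (if r = 0 then 1 else mon ([], replicate r 1))"

definition h_tilde :: "nat \<Rightarrow> sSym" where
  "h_tilde k = (\<Sum>\<Lambda> | \<Lambda> \<in> superpartitions \<and> weight \<Lambda> = k \<and> df \<Lambda> = 1.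
     of_nat (hd (fst \<Lambda>) + 1) * mon \<Lambda>)"

definition e_tilde :: "nat \<Rightarrow> sSym" where
  "e_tilde k = mon ([0], replicate k 1)"

text \<open>The index sets of the two sums above are finite.\<close>

lemma finite_superpartitions: "finite {\<Lambda>. \<Lambda> \<in> superpartitions \<and> weight \<Lambda> = r \<and> df \<Lambda> = m}"
proof (rule finite_subset)
  have len: "length M \<le> sum_list M" if "\<forall>k\<in>set M. 1 \<le> k" for M :: "nat list"
    using that by (induction M) auto
  have el: "set M \<subseteq> {..sum_list M}" for M :: "nat list"
    using member_le_sum_list[of _ M] by auto
  show "{\<Lambda>. \<Lambda> \<in> superpartitions \<and> weight \<Lambda> = r \<and> df \<Lambda> = m} \<subseteq>
      {L. set L \<subseteq> {..r} \<and> length L = m} \<times> {M. set M \<subseteq> {..r} \<and> length M \<le> r}"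
  proof
    fix \<Lambda> assume *: "\<Lambda> \<in> {\<Lambda>. \<Lambda> \<in> superpartitions \<and> weight \<Lambda> = r \<and> df \<Lambda> = m}"
    obtain L M where \<Lambda>: "\<Lambda> = (L, M)" by (cases \<Lambda>)
    have "\<forall>k\<in>set M. 1 \<le> k" "sum_list L + sum_list M = r" "length L = m"
      using * by (auto simp: \<Lambda> superpartitions_def weight_def df_def)
    then show "\<Lambda> \<in> {L. set L \<subseteq> {..r} \<and> length L = m} \<times> {M. set M \<subseteq> {..r} \<and> length M \<le> r}"
      using len[of M] el[of L] el[of M] by (fastforce simp: \<Lambda>)
  qed
qed (simp add: finite_lists_length_eq finite_lists_length_le)

end

theory Submission
  imports Defs
begin

text \<open>
  Both identities are proved by comparing the coefficient of each monomial. Every term of either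
  identity has odd degree one, so only monomials \<open>\<theta>\<^sub>i x\<^sup>a\<close> matter. Write \<open>c\<close> for the exponent of
  \<open>x\<^sub>i\<close> in \<open>x\<^sup>a\<close>. If a series \<open>f\<close> contains no anticommuting variables, the coefficient of
  \<open>\<theta>\<^sub>i x\<^sup>a\<close> in \<open>f\<close> times the odd power sum of index \<open>k\<close>, in either order, is the coefficient of
  \<open>x\<^sup>a / x\<^sub>i\<^sup>k\<close> in \<open>f\<close> when \<open>k \<le> c\<close>, and 0 otherwise (\<open>scoeff_mult_p_tilde\<close> and
  \<open>scoeff_p_tilde_mult\<close>).

  For the first identity take \<open>x\<^sup>a\<close> of degree \<open>n\<close>. In the complete symmetric function of degree
  \<open>n - k\<close> every monomial of that degree has coefficient 1, so if the odd power sum of index \<open>n\<close> is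
  read as the product for \<open>k = n\<close>, every \<open>k \<le> c\<close> contributes 1. The total is \<open>c + 1\<close>, which is the
  coefficient of \<open>\<theta>\<^sub>i x\<^sup>a\<close> in \<open>h_tilde n\<close>.

  For the second identity, \<open>x\<^sup>a / x\<^sub>i\<^sup>j\<close> occurs in an elementary symmetric function only if it is
  squarefree. So the variables other than \<open>x\<^sub>i\<close> have exponent at most 1 in \<open>x\<^sup>a\<close>, and \<open>j\<close> is
  \<open>c\<close> or \<open>c - 1\<close>. If \<open>c > 0\<close> these two contributions have opposite signs and cancel; if \<open>c = 0\<close>
  only \<open>j = 0\<close> is possible, and the squarefree monomials without \<open>x\<^sub>i\<close> that remain are those that
  accompany \<open>\<theta>\<^sub>i\<close> in \<open>e_tilde n\<close>.

  The coefficients of the generators (\<open>scoeff_h_sum\<close>, \<open>scoeff_h_tilde\<close>, \<open>scoeff_e_sum\<close>,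
  \<open>scoeff_e_tilde\<close>, \<open>scoeff_p_tilde\<close>) rest on the fact that the distinct terms of a monomial
  function with at most one anticommuting variable are exactly the monomials with the prescribed
  exponents, each with coefficient 1.
\<close>

section \<open>Coefficients of symmetric functions in superspace\<close>

definition scoeff :: "sSym \<Rightarrow> nat set \<Rightarrow> nat multiset \<Rightarrow> rat" where
  "scoeff F = coeff (Rep_sSym F)"

lemma sSym_eqI: "(\<And>S a. finite S \<Longrightarrow> scoeff F S a = scoeff G S a) \<Longrightarrow> F = G"
  unfolding scoeff_def by (metis Rep_sSym_inject superseries_eqI)

lemma scoeff_arith:
  "scoeff 0 S a = 0"
  "scoeff 1 S a = (if S = {} \<and> a = {#} then 1 else 0)"
  "scoeff (F + G) S a = scoeff F S a + scoeff G S a"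
  "scoeff (F - G) S a = scoeff F S a - scoeff G S a"
  "scoeff (- F) S a = - scoeff F S a"
  by (simp_all add: scoeff_def zero_sSym.rep_eq one_sSym.rep_eq plus_sSym.rep_eq
      minus_sSym.rep_eq uminus_sSym.rep_eq zero_superseries.rep_eq one_superseries.rep_eq
      plus_superseries.rep_eq minus_superseries.rep_eq uminus_superseries.rep_eq)

lemma scoeff_sum: "scoeff (\<Sum>x\<in>X. F x) S a = (\<Sum>x\<in>X. scoeff (F x) S a)"
  by (induction X rule: infinite_finite_induct) (simp_all add: scoeff_arith)

lemma scoeff_of_nat_mult: "scoeff (of_nat m * F) S a = of_nat m * scoeff F S a"
  by (induction m) (simp_all add: scoeff_arith algebra_simps)

lemma scoeff_sign_mult: "scoeff ((- 1) ^ m * F) S a = (- 1) ^ m * scoeff F S a"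
  by (induction m) (simp_all add: scoeff_arith mult.assoc)

lemma scoeff_mult:
  "scoeff (F * G) S a = (\<Sum>(A, b)\<in>Pow S \<times> {b. b \<subseteq># a}.
     shuffle_sign A (S - A) * scoeff F A b * scoeff G (S - A) (a - b))"
  by (simp add: scoeff_def times_sSym.rep_eq coeff_times)

section \<open>Monomials\<close>

text \<open>For finite \<open>S\<close> this is \<open>\<theta>\<^sub>S x\<^sup>a\<close>; an infinite \<open>S\<close> gives \<open>0\<close>.\<close>

lift_definition monomial :: "nat set \<Rightarrow> nat multiset \<Rightarrow> superseries"
  is "\<lambda>S a T b. if finite S \<and> T = S \<and> b = a then 1 else 0" by auto

lemma monomial_eq_iff:
  assumes "finite S" shows "monomial S a = monomial T b \<longleftrightarrow> S = T \<and> a = b"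
proof
  assume "monomial S a = monomial T b"
  then have "coeff (monomial S a) S a = coeff (monomial T b) S a" by simp
  then show "S = T \<and> a = b" using assms by (auto simp: monomial.rep_eq split: if_splits)
qed simp

lemma one_eq_monomial: "1 = monomial {} {#}"
  by (rule superseries_eqI) (simp add: monomial.rep_eq one_superseries.rep_eq)

lemma var_theta_eq_monomial: "var_theta i = monomial {i} {#}"
  by (rule superseries_eqI) (simp add: monomial.rep_eq var_theta.rep_eq)

lemma var_x_eq_monomial: "var_x i = monomial {} {#i#}"
  by (rule superseries_eqI) (simp add: monomial.rep_eq var_x.rep_eq)

lemma monomial_mult:
  assumes "finite S" shows "monomial S a * monomial {} b = monomial S (a + b)"
proof (rule superseries_eqI)
  fix T c assume T: "finite (T :: nat set)"
  have "coeff (monomial S a * monomial {} b) T c = (\<Sum>(A, d)\<in>{(T, a)} \<inter> (Pow T \<times> {d. d \<subseteq># c}).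
      shuffle_sign A (T - A) * coeff (monomial S a) A d * coeff (monomial {} b) (T - A) (c - d))"
    unfolding coeff_times
    by (rule sum.mono_neutral_right) (auto simp: T monomial.rep_eq split: if_splits)
  also have "\<dots> = coeff (monomial S (a + b)) T c"
    using assms by (auto simp: monomial.rep_eq Int_insert_left)
  finally show "coeff (monomial S a * monomial {} b) T c = coeff (monomial S (a + b)) T c" .
qed

lemma var_x_power: "var_x i ^ k = monomial {} (replicate_mset k i)"
  by (induction k) (simp_all add: one_eq_monomial var_x_eq_monomial monomial_mult)

definition exponents :: "nat list \<Rightarrow> nat list \<Rightarrow> nat multiset" where
  "exponents is ks = (\<Sum>(i, k)\<leftarrow>zip is ks. replicate_mset k i)"

lemma exponents_simps [simp]:
  "exponents is [] = {#}"
  "exponents (i # is) (k # ks) = replicate_mset k i + exponents is ks"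
  by (simp_all add: exponents_def)

lemma prod_var_x_powers:
  "prod_list (map2 (\<lambda>i k. var_x i ^ k) is ks) = monomial {} (exponents is ks)"
proof (induction ks arbitrary: "is")
  case (Cons k ks)
  then show ?case
    by (cases "is") (simp_all add: exponents_def one_eq_monomial var_x_power monomial_mult)
qed (simp add: one_eq_monomial)

lemma super_term_df_0: "super_term ([], M) is = monomial {} (exponents is M)"
  using monomial_mult[of "{}" "{#}" "exponents is M"]
  by (simp add: super_term_def df_def prod_var_x_powers one_eq_monomial)

lemma super_term_df_1:
  "super_term ([l], M) (i # is) = monomial {i} (replicate_mset l i + exponents is M)"
  using prod_var_x_powers[of "i # is" "l # M"]
  by (simp add: super_term_def df_def var_theta_eq_monomial monomial_mult)

section \<open>Shapes\<close>

text \<open>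
  The partition formed by the nonzero exponents of \<open>x\<^sup>a\<close>, kept as a multiset so that it does not
  depend on an order of the variables.
\<close>

definition shape :: "nat multiset \<Rightarrow> nat multiset" where
  "shape a = image_mset (count a) (mset_set (set_mset a))"

lemma sum_shape: "\<Sum>\<^sub># (shape a) = size a"
  by (simp add: shape_def size_multiset_overloaded_eq sum_unfold_sum_mset)

lemma shape_pos: "k \<in># shape a \<Longrightarrow> 1 \<le> k"
  by (auto simp: shape_def Suc_le_eq)

lemma shape_empty_iff: "shape a = {#} \<longleftrightarrow> a = {#}"
  by (simp add: shape_def mset_set_empty_iff)

lemma shape_add_replicate:
  assumes "i \<notin># a" "1 \<le> k"
  shows "shape (replicate_mset k i + a) = add_mset k (shape a)"
proof -
  have "set_mset (replicate_mset k i + a) = insert i (set_mset a)"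
    using assms(2) by auto
  then have "shape (replicate_mset k i + a) = add_mset (count (replicate_mset k i + a) i)
      (image_mset (count (replicate_mset k i + a)) (mset_set (set_mset a)))"
    using assms(1) by (simp add: shape_def)
  also have "image_mset (count (replicate_mset k i + a)) (mset_set (set_mset a)) = shape a"
    unfolding shape_def using assms(1) by (intro image_mset_cong) auto
  finally show ?thesis using assms(1) by (simp add: not_in_iff)
qed

lemma split_off_variable: "a = replicate_mset (count a i) i + filter_mset (\<lambda>j. j \<noteq> i) a"
  by (auto simp: multiset_eq_iff)

lemma set_mset_exponents:
  assumes "length is = length M" "\<forall>k\<in>set M. 1 \<le> k"
  shows "set_mset (exponents is M) = set is"
  using assms by (induction "is" M rule: list_induct2) auto

lemma shape_exponents:
  assumes "length is = length M" "distinct is" "\<forall>k\<in>set M. 1 \<le> k"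
  shows "shape (exponents is M) = mset M"
  using assms
proof (induction "is" M rule: list_induct2)
  case (Cons i "is" k M)
  then show ?case by (simp add: shape_add_replicate set_mset_exponents)
qed (simp add: shape_def)

text \<open>
  Together with \<open>shape_exponents\<close> this shows, for positive parts, that \<open>x\<^sup>a\<close> arises from some
  assignment of distinct variables to the parts of \<open>M\<close> exactly if \<open>M\<close> lists the nonzero exponents
  of \<open>a\<close>. The variables are chosen part by part: a variable with exponent equal to the first part
  exists, and removing it from \<open>a\<close> removes that part from the shape.
\<close>

lemma exponents_of_shape:
  "shape a = mset M \<Longrightarrow> \<exists>is. distinct is \<and> length is = length M \<and> exponents is M = a"
proof (induction M arbitrary: a)
  case Nil
  then show ?case by (simp add: shape_empty_iff)
next
  case (Cons k M)
  have "k \<in># shape a" using Cons.prems by simp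
  then obtain i where i: "i \<in># a" "count a i = k" by (auto simp: shape_def)
  define b where "b = filter_mset (\<lambda>j. j \<noteq> i) a"
  have a: "a = replicate_mset k i + b"
    using split_off_variable[of a i] i by (simp add: b_def)
  have "1 \<le> k" "i \<notin># b" using i by (auto simp: b_def Suc_le_eq)
  then have "shape b = mset M"
    using Cons.prems shape_add_replicate[of i b k] by (simp add: a)
  then obtain "is" where "is": "distinct is" "length is = length M" "exponents is M = b"
    using Cons.IH by blast
  have "\<forall>k\<in>set M. 1 \<le> k"
    using \<open>shape b = mset M\<close> shape_pos by (metis set_mset_mset)
  then have "i \<notin> set is" using set_mset_exponents "is" \<open>i \<notin># b\<close> by metis
  then show ?case using "is" a by (intro exI[of _ "i # is"]) simp
qed

text \<open>
  This is why a monomial belongs to a single monomial function: its exponents determine the parts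
  of the superpartition up to order, and the parts are listed in weakly decreasing order.
\<close>

lemma sorted_desc_unique:
  assumes "sorted_wrt (\<ge>) M"
  shows "mset M = A \<longleftrightarrow> M = rev (sorted_list_of_multiset (A :: nat multiset))"
proof -
  have "sorted (rev M)" using assms by (simp add: sorted_wrt_rev)
  then show ?thesis
    by (metis mset_rev mset_sorted_list_of_multiset rev_rev_ident sorted_list_of_multiset_mset
        sorted_sort_id)
qed

lemma sorted_desc_of_multiset: "sorted_wrt (\<ge>) (rev (sorted_list_of_multiset (A :: nat multiset)))"
  by (simp add: sorted_wrt_rev)

lemma sorted_desc_in_superpartitions:
  "(L, rev (sorted_list_of_multiset (shape a))) \<in> superpartitions \<longleftrightarrow> sorted_wrt (>) L"
  unfolding superpartitions_def
  using shape_pos[of _ a] sorted_desc_of_multiset[of "shape a"] by simp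

lemma sum_list_sorted_list_of_multiset:
  "sum_list (sorted_list_of_multiset (A :: nat multiset)) = \<Sum>\<^sub># A"
  by (metis mset_sorted_list_of_multiset sum_mset_sum_list)

section \<open>Coefficients of the generators\<close>

text \<open>
  A monomial function is the sum over the set of its terms, so a term that is given by several
  index lists counts once. If the terms are monomials without signs, which is the case with at most
  one anticommuting variable, the coefficient is the indicator of membership in the set.
\<close>

lemma coeff_formal_sum_monomials:
  assumes "\<And>t. t \<in> T \<Longrightarrow> \<exists>S a. finite S \<and> t = monomial S a"
  shows "coeff (formal_sum (\<lambda>t. t) T) S a = (if finite S \<and> monomial S a \<in> T then 1 else 0)"
proof -
  have "{t \<in> T. coeff t S a \<noteq> 0} = (if finite S then {monomial S a} \<inter> T else {})"
    using assms by (fastforce simp: monomial.rep_eq split: if_splits)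
  then show ?thesis by (auto simp: formal_sum.rep_eq monomial.rep_eq)
qed

lemma monomial_in_super_terms_df_0:
  assumes M: "\<forall>k\<in>set M. 1 \<le> k" and S: "finite S"
  shows "monomial S a \<in> super_terms ([], M) \<longleftrightarrow> S = {} \<and> mset M = shape a"
proof
  assume "monomial S a \<in> super_terms ([], M)"
  then obtain "is" where "is": "distinct is" "length is = length M"
    and eq: "monomial S a = super_term ([], M) is"
    by (auto simp: super_terms_def)
  show "S = {} \<and> mset M = shape a"
    using eq S shape_exponents[OF "is"(2) "is"(1) M]
    by (simp add: super_term_df_0 monomial_eq_iff)
next
  assume *: "S = {} \<and> mset M = shape a"
  then obtain "is" where "distinct is" "length is = length M" "exponents is M = a"
    using exponents_of_shape[of a M] by auto
  then show "monomial S a \<in> super_terms ([], M)"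
    using * unfolding super_terms_def
    by (intro CollectI exI[of _ "is"]) (simp add: super_term_df_0)
qed

lemma scoeff_mon_df_0:
  assumes "\<forall>k\<in>set M. 1 \<le> k"
  shows "scoeff (mon ([], M)) S a = (if S = {} \<and> mset M = shape a then 1 else 0)"
proof -
  have "\<exists>S a. finite S \<and> t = monomial S a" if "t \<in> super_terms ([], M)" for t
    using that unfolding super_terms_def super_term_df_0 by blast
  then show ?thesis
    unfolding scoeff_def mon.rep_eq
    by (subst coeff_formal_sum_monomials) (auto simp: monomial_in_super_terms_df_0[OF assms])
qed

text \<open>
  The first part \<open>l\<close> is the exponent of the variable that is paired with \<open>\<theta>\<close>. It may be 0, unlike
  the other parts, so this variable is set aside before the shape of the rest is compared with
  \<open>M\<close>.
\<close>

lemma monomial_in_super_terms_df_1: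
  assumes M: "\<forall>k\<in>set M. 1 \<le> k" and S: "finite S"
  shows "monomial S a \<in> super_terms ([l], M) \<longleftrightarrow>
    (\<exists>i. S = {i} \<and> l = count a i \<and> mset M = shape (filter_mset (\<lambda>j. j \<noteq> i) a))"
proof
  assume "monomial S a \<in> super_terms ([l], M)"
  then obtain i "is" where "is": "distinct (i # is)" "length is = length M"
    and eq: "monomial S a = super_term ([l], M) (i # is)"
    by (auto simp: super_terms_def length_Suc_conv)
  have Sa: "S = {i}" "a = replicate_mset l i + exponents is M"
    using eq S by (auto simp: super_term_df_1 monomial_eq_iff)
  have i: "i \<notin># exponents is M" using "is" M by (simp add: set_mset_exponents)
  then have "filter_mset (\<lambda>j. j \<noteq> i) (exponents is M) = exponents is M"
    by (auto intro!: filter_mset_cong simp: filter_mset_eq_conv)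
  then have "l = count a i" "filter_mset (\<lambda>j. j \<noteq> i) a = exponents is M"
    using i by (auto simp: Sa(2) not_in_iff)
  then show "\<exists>i. S = {i} \<and> l = count a i \<and> mset M = shape (filter_mset (\<lambda>j. j \<noteq> i) a)"
    using Sa(1) shape_exponents "is" M by auto
next
  assume "\<exists>i. S = {i} \<and> l = count a i \<and> mset M = shape (filter_mset (\<lambda>j. j \<noteq> i) a)"
  then obtain i where i: "S = {i}" "l = count a i" "shape (filter_mset (\<lambda>j. j \<noteq> i) a) = mset M"
    by auto
  then obtain "is" where "is": "distinct is" "length is = length M"
    "exponents is M = filter_mset (\<lambda>j. j \<noteq> i) a"
    using exponents_of_shape by blast
  have "i \<notin> set is" using set_mset_exponents[OF "is"(2) M] "is"(3) by auto
  moreover have "monomial S a = super_term ([l], M) (i # is)"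
    using split_off_variable[of a i] by (simp add: super_term_df_1 i "is"(3))
  ultimately show "monomial S a \<in> super_terms ([l], M)"
    using "is" unfolding super_terms_def by (intro CollectI exI[of _ "i # is"]) simp
qed

lemma scoeff_mon_df_1:
  assumes "\<forall>k\<in>set M. 1 \<le> k"
  shows "scoeff (mon ([l], M)) S a =
    (if \<exists>i. S = {i} \<and> l = count a i \<and> mset M = shape (filter_mset (\<lambda>j. j \<noteq> i) a) then 1 else 0)"
proof -
  have "\<exists>S a. finite S \<and> t = monomial S a" if t: "t \<in> super_terms ([l], M)" for t
  proof -
    obtain i "is" where "t = super_term ([l], M) (i # is)"
      using t by (auto simp: super_terms_def length_Suc_conv)
    then show ?thesis unfolding super_term_df_1 by blast
  qed
  then show ?thesis
    unfolding scoeff_def mon.rep_eq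
    by (subst coeff_formal_sum_monomials) (auto simp: monomial_in_super_terms_df_1[OF assms])
qed

lemma scoeff_h_sum: "scoeff (h_sum r) S a = (if S = {} \<and> size a = r then 1 else 0)"
proof -
  let ?X = "{\<Lambda>. \<Lambda> \<in> superpartitions \<and> weight \<Lambda> = r \<and> df \<Lambda> = 0}"
  let ?\<Lambda> = "([], rev (sorted_list_of_multiset (shape a))) :: superpart"
  have "scoeff (h_sum r) S a = (\<Sum>\<Lambda>\<in>?X. if S = {} \<and> \<Lambda> = ?\<Lambda> then 1 else 0)"
    unfolding h_sum_def scoeff_sum
  proof (rule sum.cong[OF refl])
    fix \<Lambda> assume "\<Lambda> \<in> ?X"
    then obtain M where "\<Lambda> = ([], M)" "\<forall>k\<in>set M. 1 \<le> k" "sorted_wrt (\<ge>) M"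
      by (auto simp: superpartitions_def df_def)
    then show "scoeff (mon \<Lambda>) S a = (if S = {} \<and> \<Lambda> = ?\<Lambda> then 1 else 0)"
      by (simp add: scoeff_mon_df_0 sorted_desc_unique)
  qed
  also have "\<dots> = (if S = {} \<and> ?\<Lambda> \<in> ?X then 1 else 0)"
    using finite_superpartitions[of r 0] by (cases "S = {}") simp_all
  also have "?\<Lambda> \<in> ?X \<longleftrightarrow> size a = r"
    by (simp add: sorted_desc_in_superpartitions sum_shape weight_def df_def
        sum_list_sorted_list_of_multiset)
  finally show ?thesis .
qed

text \<open>
  The only superpartition whose monomial function contains \<open>\<theta>\<^sub>i x\<^sup>a\<close> has the exponent of \<open>x\<^sub>i\<close>
  as its first part, so the factor \<open>\<Lambda>\<^sub>1 + 1\<close> becomes \<open>count a i + 1\<close>.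
\<close>

lemma scoeff_h_tilde:
  "scoeff (h_tilde r) {i} a = (if size a = r then of_nat (count a i + 1) else 0)"
  "(\<And>i. S \<noteq> {i}) \<Longrightarrow> scoeff (h_tilde r) S a = 0"
proof -
  let ?X = "{\<Lambda>. \<Lambda> \<in> superpartitions \<and> weight \<Lambda> = r \<and> df \<Lambda> = 1}"
  let ?b = "filter_mset (\<lambda>j. j \<noteq> i) a"
  let ?\<Lambda> = "([count a i], rev (sorted_list_of_multiset (shape ?b))) :: superpart"
  have X: "\<exists>l M. \<Lambda> = ([l], M) \<and> (\<forall>k\<in>set M. 1 \<le> k) \<and> sorted_wrt (\<ge>) M" if "\<Lambda> \<in> ?X" for \<Lambda>
    using that by (auto simp: superpartitions_def df_def length_Suc_conv)
  have "scoeff (h_tilde r) {i} a =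
      (\<Sum>\<Lambda>\<in>?X. if \<Lambda> = ?\<Lambda> then of_nat (count a i + 1) else 0)"
    unfolding h_tilde_def scoeff_sum
  proof (rule sum.cong[OF refl])
    fix \<Lambda> assume "\<Lambda> \<in> ?X"
    then obtain l M where "\<Lambda> = ([l], M)" "\<forall>k\<in>set M. 1 \<le> k" "sorted_wrt (\<ge>) M"
      using X by blast
    then show "scoeff (of_nat (hd (fst \<Lambda>) + 1) * mon \<Lambda>) {i} a =
        (if \<Lambda> = ?\<Lambda> then of_nat (count a i + 1) else 0)"
      unfolding scoeff_of_nat_mult by (simp add: scoeff_mon_df_1 sorted_desc_unique)
  qed
  also have "\<dots> = (if ?\<Lambda> \<in> ?X then of_nat (count a i + 1) else 0)"
    using finite_superpartitions[of r 1] by simp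
  also have "?\<Lambda> \<in> ?X \<longleftrightarrow> size a = r"
  proof -
    have "size a = count a i + size ?b"
      using arg_cong[OF split_off_variable[of a i], of size] by simp
    then show ?thesis
      by (simp add: sorted_desc_in_superpartitions sum_shape weight_def df_def
          sum_list_sorted_list_of_multiset)
  qed
  finally show "scoeff (h_tilde r) {i} a = (if size a = r then of_nat (count a i + 1) else 0)" .
  assume "\<And>i. S \<noteq> {i}"
  then show "scoeff (h_tilde r) S a = 0"
    unfolding h_tilde_def scoeff_sum scoeff_of_nat_mult
    using X by (intro sum.neutral) (fastforce simp: scoeff_mon_df_1)
qed

lemma shape_ones_iff: "shape a = replicate_mset k 1 \<longleftrightarrow> size a = k \<and> (\<forall>j. count a j \<le> 1)"
proof -
  have le: "(\<forall>j. count a j \<le> 1) \<longleftrightarrow> (\<forall>x\<in>#shape a. x = 1)"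
  proof
    assume "\<forall>x\<in>#shape a. x = 1"
    then have "count a j = 1" if "j \<in># a" for j using that by (auto simp: shape_def)
    then show "\<forall>j. count a j \<le> 1" by (metis le_refl not_in_iff zero_le)
  next
    assume le: "\<forall>j. count a j \<le> 1"
    have "count a j = 1" if "j \<in># a" for j
      using le[rule_format, of j] that by (simp add: le_less Suc_le_eq flip: count_greater_zero_iff)
    then show "\<forall>x\<in>#shape a. x = 1" by (auto simp: shape_def)
  qed
  show ?thesis
  proof
    assume "shape a = replicate_mset k 1"
    then show "size a = k \<and> (\<forall>j. count a j \<le> 1)"
      using le sum_shape[of a] by simp
  next
    assume R: "size a = k \<and> (\<forall>j. count a j \<le> 1)"
    then have "shape a = replicate_mset (size (shape a)) 1"
      using le by (metis set_mset_replicate_mset_subset size_replicate_mset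
        set_mset_subset_singletonD subsetI singletonI insertI1)
    moreover from this have "size (shape a) = k"
      using sum_shape[of a] R by (metis sum_mset_replicate_mset mult.right_neutral of_nat_id)
    ultimately show "shape a = replicate_mset k 1" by simp
  qed
qed

lemma scoeff_e_sum:
  "scoeff (e_sum r) S a = (if S = {} \<and> size a = r \<and> (\<forall>j. count a j \<le> 1) then 1 else 0)"
proof (cases "r = 0")
  case True
  then show ?thesis by (auto simp: e_sum_def scoeff_arith)
next
  case False
  then show ?thesis
    using shape_ones_iff[of a r]
    by (simp add: e_sum_def scoeff_mon_df_0 eq_commute[of "replicate_mset r _"])
qed

lemma scoeff_e_tilde:
  "scoeff (e_tilde r) {i} a =
    (if size a = r \<and> count a i = 0 \<and> (\<forall>j. count a j \<le> 1) then 1 else 0)"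
  "(\<And>i. S \<noteq> {i}) \<Longrightarrow> scoeff (e_tilde r) S a = 0"
proof -
  have "filter_mset (\<lambda>j. j \<noteq> i) a = a" if "count a i = 0"
    using that by (auto simp: multiset_eq_iff)
  then show "scoeff (e_tilde r) {i} a =
      (if size a = r \<and> count a i = 0 \<and> (\<forall>j. count a j \<le> 1) then 1 else 0)"
    using shape_ones_iff[of a r]
    by (auto simp: e_tilde_def scoeff_mon_df_1 eq_commute[of "replicate_mset r _"] not_in_iff)
qed (auto simp: e_tilde_def scoeff_mon_df_1)

lemma scoeff_p_tilde:
  "scoeff (p_tilde k) S a = (if \<exists>i. S = {i} \<and> a = replicate_mset k i then 1 else 0)"
proof -
  have c: "coeff (var_theta i * var_x i ^ k) T b =
      (if T = {i} \<and> b = replicate_mset k i then 1 else 0)" for i T b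
    by (simp add: var_theta_eq_monomial var_x_power monomial_mult monomial.rep_eq)
  show ?thesis
  proof (cases "\<exists>i. S = {i} \<and> a = replicate_mset k i")
    case True
    then obtain i where Sa: "S = {i}" "a = replicate_mset k i" by blast
    then have "{j. S = {j} \<and> a = replicate_mset k j} = {i}" by auto
    with Sa show ?thesis by (simp add: scoeff_def p_tilde.rep_eq formal_sum.rep_eq c)
  qed (auto simp: scoeff_def p_tilde.rep_eq formal_sum.rep_eq c)
qed

section \<open>Multiplication by an odd power sum\<close>

lemma diff_eq_replicate_iff:
  assumes "b \<subseteq># a"
  shows "a - b = replicate_mset k i \<longleftrightarrow> k \<le> count a i \<and> b = a - replicate_mset k i"
proof
  assume eq: "a - b = replicate_mset k i"
  then have "a = replicate_mset k i + b" using assms by (metis subset_mset.diff_add)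
  then show "k \<le> count a i \<and> b = a - replicate_mset k i" by simp
next
  assume "k \<le> count a i \<and> b = a - replicate_mset k i"
  then show "a - b = replicate_mset k i"
    by (auto simp: multiset_eq_iff)
qed

text \<open>
  Since \<open>F\<close> has no anticommuting variables, the factor \<open>\<theta>\<^sub>i\<close> can only come from the term
  \<open>\<theta>\<^sub>i x\<^sub>i\<^sup>k\<close> of the power sum. So at most one summand of the product is nonzero, and its shuffle
  sign is 1.
\<close>

lemma scoeff_mult_p_tilde:
  assumes F: "\<And>S a. S \<noteq> {} \<Longrightarrow> scoeff F S a = 0"
  shows "scoeff (F * p_tilde k) {i} a =
      (if k \<le> count a i then scoeff F {} (a - replicate_mset k i) else 0)"
    and "(\<And>i. S \<noteq> {i}) \<Longrightarrow> scoeff (F * p_tilde k) S a = 0"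
proof -
  have "scoeff (F * p_tilde k) {i} a = (\<Sum>(A, b)\<in>{({} :: nat set, a - replicate_mset k i)}.
      if k \<le> count a i then scoeff F {} (a - replicate_mset k i) else 0)"
    unfolding scoeff_mult
    by (rule sum.mono_neutral_cong_right)
       (auto simp: F scoeff_p_tilde diff_eq_replicate_iff split: if_splits)
  then show "scoeff (F * p_tilde k) {i} a =
      (if k \<le> count a i then scoeff F {} (a - replicate_mset k i) else 0)"
    by simp
  assume "\<And>i. S \<noteq> {i}"
  then have p: "scoeff (p_tilde k) S b = 0" for b by (simp add: scoeff_p_tilde)
  have "scoeff F A b * scoeff (p_tilde k) (S - A) c = 0" for A b c
    using p F[of A b] by (cases "A = {}") auto
  then show "scoeff (F * p_tilde k) S a = 0"
    unfolding scoeff_mult by (intro sum.neutral) (auto simp: mult.assoc)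
qed

lemma scoeff_p_tilde_mult:
  assumes F: "\<And>S a. S \<noteq> {} \<Longrightarrow> scoeff F S a = 0"
  shows "scoeff (p_tilde k * F) {i} a =
      (if k \<le> count a i then scoeff F {} (a - replicate_mset k i) else 0)"
    and "(\<And>i. S \<noteq> {i}) \<Longrightarrow> scoeff (p_tilde k * F) S a = 0"
proof -
  have "scoeff (p_tilde k * F) {i} a = (\<Sum>(A, b)\<in>{({i}, replicate_mset k i)}.
      if k \<le> count a i then scoeff F {} (a - replicate_mset k i) else 0)"
    unfolding scoeff_mult
    by (rule sum.mono_neutral_cong)
       (auto simp: F scoeff_p_tilde count_le_replicate_mset_subset_eq split: if_splits)
  then show "scoeff (p_tilde k * F) {i} a =
      (if k \<le> count a i then scoeff F {} (a - replicate_mset k i) else 0)"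
    by simp
  assume "\<And>i. S \<noteq> {i}"
  then have p: "scoeff (p_tilde k) S b = 0" for b by (simp add: scoeff_p_tilde)
  have "scoeff (p_tilde k) A b * scoeff F (S - A) c = 0" if "A \<subseteq> S" for A b c
    using that p F[of "S - A" c] by (cases "A = S") auto
  then show "scoeff (p_tilde k * F) S a = 0"
    unfolding scoeff_mult by (intro sum.neutral) auto
qed

section \<open>The two recursions\<close>

lemma h_tilde_eq_sum: "h_tilde n = p_tilde n + (\<Sum>k<n. h_sum (n - k) * p_tilde k)"
proof (rule sSym_eqI)
  fix S :: "nat set" and a :: "nat multiset"
  have h: "scoeff (h_sum r) T b = 0" if "T \<noteq> {}" for r T b
    using that by (simp add: scoeff_h_sum)
  show "scoeff (h_tilde n) S a = scoeff (p_tilde n + (\<Sum>k<n. h_sum (n - k) * p_tilde k)) S a"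
  proof (cases "\<exists>i. S = {i}")
    case True
    then obtain i where S: "S = {i}" ..
    have p: "a = replicate_mset n i \<longleftrightarrow> size a = n \<and> count a i = n"
      by (metis count_le_replicate_mset_subset_eq count_replicate_mset le_refl
          mset_subset_size size_replicate_mset nat_less_le subset_mset.le_imp_less_or_eq)
    have c: "count a i \<le> size a"
      using arg_cong[OF split_off_variable[of a i], of size] by simp
    have t: "scoeff (h_sum (n - k) * p_tilde k) S a =
        (if size a = n \<and> k \<le> count a i then 1 else 0)" if "k < n" for k
      using that c
      by (auto simp: S scoeff_mult_p_tilde[OF h] scoeff_h_sum size_Diff_submset
          count_le_replicate_mset_subset_eq[symmetric])
    have "scoeff (\<Sum>k<n. h_sum (n - k) * p_tilde k) S a =
        (if size a = n then of_nat (card {k. k < n \<and> k \<le> count a i}) else 0)"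
      by (simp add: scoeff_sum t sum.If_cases Int_def)
    \<comment> \<open>If \<open>count a i = n\<close>, this set has \<open>n\<close> elements, one short of \<open>count a i + 1\<close>; the missing 1
      is the coefficient in \<open>p_tilde n\<close>.\<close>
    moreover have "{k. k < n \<and> k \<le> count a i} = (if count a i = n then {..<n} else {..count a i})"
      if "size a = n" using c that by auto
    ultimately show ?thesis
      by (auto simp: S scoeff_arith scoeff_h_tilde(1) scoeff_p_tilde p)
  next
    case False
    then show ?thesis
      by (auto simp: scoeff_arith scoeff_sum scoeff_mult_p_tilde(2)[OF h] scoeff_h_tilde(2)
          scoeff_p_tilde)
  qed
qed

lemma e_tilde_eq_sum:
  "e_tilde n = (\<Sum>j\<le>n. (- 1) ^ j * p_tilde j * e_sum (n - j))"
proof (rule sSym_eqI)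
  fix S :: "nat set" and a :: "nat multiset"
  have e: "scoeff (e_sum r) T b = 0" if "T \<noteq> {}" for r T b
    using that by (simp add: scoeff_e_sum)
  show "scoeff (e_tilde n) S a = scoeff (\<Sum>j\<le>n. (- 1) ^ j * p_tilde j * e_sum (n - j)) S a"
  proof (cases "\<exists>i. S = {i}")
    case True
    then obtain i where S: "S = {i}" ..
    let ?c = "count a i"
    define P where "P \<longleftrightarrow> size a = n \<and> (\<forall>j. j \<noteq> i \<longrightarrow> count a j \<le> 1)"
    have c: "?c \<le> size a"
      using arg_cong[OF split_off_variable[of a i], of size] by simp
    have t: "scoeff (p_tilde j * e_sum (n - j)) S a =
        (if P \<and> j \<le> ?c \<and> ?c \<le> Suc j then 1 else 0)" if "j \<le> n" for j
    proof (cases "j \<le> ?c")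
      case True
      then have "size (a - replicate_mset j i) = size a - j"
        by (simp add: size_Diff_submset count_le_replicate_mset_subset_eq[symmetric])
      moreover have "(\<forall>l. count (a - replicate_mset j i) l \<le> 1) \<longleftrightarrow>
          (\<forall>l. l \<noteq> i \<longrightarrow> count a l \<le> 1) \<and> ?c \<le> Suc j"
        by (auto split: if_splits)
      ultimately show ?thesis using True that c
        by (auto simp: P_def S scoeff_p_tilde_mult[OF e] scoeff_e_sum)
    qed (simp add: S scoeff_p_tilde_mult[OF e])
    have "scoeff (\<Sum>j\<le>n. (- 1) ^ j * p_tilde j * e_sum (n - j)) S a =
        (\<Sum>j\<le>n. if P \<and> j \<le> ?c \<and> ?c \<le> Suc j then (- 1) ^ j else 0)"
      unfolding scoeff_sum mult.assoc scoeff_sign_mult by (intro sum.cong) (auto simp: t)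
    also have "\<dots> = (if P \<and> ?c = 0 then 1 else 0)"
    proof (cases P)
      case P: True
      have "(\<Sum>j\<le>n. if P \<and> j \<le> ?c \<and> ?c \<le> Suc j then (- 1) ^ j else 0) =
          (\<Sum>j | j \<le> ?c \<and> ?c \<le> Suc j. (- 1 :: rat) ^ j)"
        using P c unfolding P_def by (intro sum.mono_neutral_cong_right) auto
      \<comment> \<open>Dividing by \<open>x\<^sub>i\<^sup>j\<close> must leave exponent 0 or 1 of \<open>x\<^sub>i\<close>. For positive \<open>?c\<close> both are
        possible and their signs cancel.\<close>
      also have "{j. j \<le> ?c \<and> ?c \<le> Suc j} = (if ?c = 0 then {0} else {?c - 1, ?c})"
        by auto
      also have "(\<Sum>j\<in>\<dots>. (- 1 :: rat) ^ j) = (if ?c = 0 then 1 else 0)"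
        by (cases ?c) simp_all
      finally show ?thesis using P by simp
    qed auto
    also have "P \<and> ?c = 0 \<longleftrightarrow> size a = n \<and> ?c = 0 \<and> (\<forall>j. count a j \<le> 1)"
      unfolding P_def by (metis zero_le)
    also have "(if \<dots> then 1 else 0) = scoeff (e_tilde n) S a"
      by (simp add: S scoeff_e_tilde(1))
    finally show ?thesis ..
  next
    case False
    then show ?thesis
      by (auto simp: scoeff_sum mult.assoc scoeff_sign_mult scoeff_p_tilde_mult(2)[OF e]
          scoeff_e_tilde(2))
  qed
qed

theorem proposition7p4:
  fixes n :: nat
  assumes "n \<ge> 1"
  shows "p_tilde n = h_tilde n - (\<Sum>k = 0..n - 1. h_sum (n - k) * p_tilde k)
    \<and> e_tilde n = (\<Sum>k = 0..n. (- 1) ^ (n - k) * p_tilde (n - k) * e_sum k)"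
proof
  have "{0..n - 1} = {..<n}" using assms by auto
  then show "p_tilde n = h_tilde n - (\<Sum>k = 0..n - 1. h_sum (n - k) * p_tilde k)"
    using h_tilde_eq_sum[of n] by simp
  have "(\<Sum>j\<le>n. (- 1) ^ j * p_tilde j * e_sum (n - j)) =
      (\<Sum>k = 0..n. (- 1) ^ (n - k) * p_tilde (n - k) * e_sum k)"
    by (rule sum.reindex_bij_witness[of _ "\<lambda>k. n - k" "\<lambda>k. n - k"]) auto
  then show "e_tilde n = (\<Sum>k = 0..n. (- 1) ^ (n - k) * p_tilde (n - k) * e_sum k)"
    by (simp add: e_tilde_eq_sum)
qed

end
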